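(* Let $\varphi(z)=az+b$ with $a,b\in\mathbb{C}$. Consider the following statements. (1) $a=0$, i.e. $\varphi(z)=b$, with $\operatorname{Re}(b)>\frac{L}{2}-\beta_*$. (2) $a\in\mathcal{R}(\Lambda)$, $\operatorname{Re}(b)\ge(1-a)\left(\frac{L}{2}-\beta_*\right)$, and the sequence $\big(r_n(a,\operatorname{Re}(b))\big)_{n\ge1}$ is bounded. Then: (i) If $\lambda_1=0$, then $C_\varphi$ is a bounded composition operator on $\mathcal{H}(\beta,\Lambda)$ if and only if either (1) or (2) holds. (ii) If $\lambda_1>0$, then $C_\varphi$ is a bounded composition operator on $\mathcal{H}(\beta,\Lambda)$ if and only if (2) holds.
   Context: $\mathbb{N}=\{1,2,\dots\}$. $\Lambda=(\lambda_n)_{n\ge1}$ is a strictly increasing sequence of non-negative real numbers tending to $\infty$ with $L:=\limsup_{n\to\infty}\frac{\log n}{\lambda_n}<\infty$. $\beta=(\beta_n)_{n\ge1}$ is a sequence of positive real numbers with $\beta_*:=\liminf_{n\to\infty}\frac{\log\beta_n}{\lambda_n}\neq\pm\infty$. For $r\in\mathbb{R}$, $\mathbb{C}_r=\{z\in\mathbb{C}:\operatorname{Re}(z)>r\}$. $\mathcal{H}(\beta,\Lambda)$ is the space of Dirichlet series $f(z)=\sum_{n=1}^\infty a_ne^{-\lambda_nz}$ with $\sum_{n=1}^\infty|a_n|^2\beta_n^2<\infty$; such series converge to holomorphic functions on $\mathbb{C}_{L/2-\beta_*}$, their coefficients are uniquely determined by $f$, and $\mathcal{H}(\beta,\Lambda)$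 is a Hilbert space with inner product $\langle f,g\rangle=\sum_{n}a_n\overline{b_n}\beta_n^2$. $C_\varphi f=f\circ\varphi$; "$C_\varphi$ is a bounded composition operator on $\mathcal{H}(\beta,\Lambda)$" means that $\varphi$ is a holomorphic self-map of $\mathbb{C}_{L/2-\beta_*}$ and $C_\varphi$ maps $\mathcal{H}(\beta,\Lambda)$ into itself boundedly. $\mathcal{R}(\Lambda)=\{r\in[1,\infty):\forall n\in\mathbb{N}\ \exists m\ge n,\ r\lambda_n=\lambda_m\}$. For $a\in\mathcal{R}(\Lambda)$ and $n\in\mathbb{N}$, $m_n\geq n$ denotes the unique index with $a\lambda_n=\lambda_{m_n}$, and for $x\in\mathbb{R}$, $r_n(a,x)=e^{-\lambda_nx}\frac{\beta_{m_n}}{\beta_n}$. *)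

theory Defs
  imports "HOL-Complex_Analysis.Complex_Analysis"
begin

text \<open>
  All sequences are indexed from 0, i.e. \<open>lam n\<close> stands for the frequency \<open>\<lambda>\<^sub>n\<^sub>+\<^sub>1\<close>, \<open>beta n\<close> for
  the weight \<open>\<beta>\<^sub>n\<^sub>+\<^sub>1\<close>, and so on; in particular \<open>lam 0\<close> is \<open>\<lambda>\<^sub>1\<close>. If \<open>lam 0 = 0\<close>, the quotients
  below have the value 0 at the index 0, which affects neither the limit superior nor the limit
  inferior.
\<close>

definition L_sup :: "(nat \<Rightarrow> real) \<Rightarrow> ereal" where
  "L_sup lam = limsup (\<lambda>n. ereal (ln (real (Suc n)) / lam n))"

definition beta_star :: "(nat \<Rightarrow> real) \<Rightarrow> (nat \<Rightarrow> real) \<Rightarrow> ereal" where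
  "beta_star lam beta = liminf (\<lambda>n. ereal (ln (beta n) / lam n))"

text \<open>The number \<open>L/2 - \<beta>\<^sub>*\<close>; only meaningful when both quantities are finite.\<close>

definition abscissa :: "(nat \<Rightarrow> real) \<Rightarrow> (nat \<Rightarrow> real) \<Rightarrow> real" where
  "abscissa lam beta = real_of_ereal (L_sup lam) / 2 - real_of_ereal (beta_star lam beta)"

definition half_plane :: "real \<Rightarrow> complex set" where
  "half_plane r = {z. Re z > r}"

definition is_coeffs ::
    "(nat \<Rightarrow> real) \<Rightarrow> (nat \<Rightarrow> real) \<Rightarrow> (complex \<Rightarrow> complex) \<Rightarrow> (nat \<Rightarrow> complex) \<Rightarrow> bool" where
  "is_coeffs lam beta f c \<longleftrightarrow>
     summable (\<lambda>n. (cmod (c n))\<^sup>2 * (beta n)\<^sup>2) \<and>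
     (\<forall>z \<in> half_plane (abscissa lam beta).
        (\<lambda>n. c n * exp (- complex_of_real (lam n) * z)) sums f z)"

text \<open>
  The weighted Hardy space of Dirichlet series. Its elements are functions on the half-plane
  \<open>half_plane (abscissa lam beta)\<close>, represented by total functions whose values outside the
  half-plane are irrelevant: membership, coefficients and norm only depend on the values inside.
\<close>

definition dirichlet_space ::
    "(nat \<Rightarrow> real) \<Rightarrow> (nat \<Rightarrow> real) \<Rightarrow> (complex \<Rightarrow> complex) set" where
  "dirichlet_space lam beta = {f. \<exists>c. is_coeffs lam beta f c}"

text \<open>The coefficients are unique by the uniqueness theorem for general Dirichlet series.\<close>

definition dirichlet_coeffs ::
    "(nat \<Rightarrow> real) \<Rightarrow> (nat \<Rightarrow> real) \<Rightarrow> (complex \<Rightarrow> complex) \<Rightarrow> nat \<Rightarrow> complex" where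
  "dirichlet_coeffs lam beta f = (THE c. is_coeffs lam beta f c)"

definition dirichlet_inner ::
    "(nat \<Rightarrow> real) \<Rightarrow> (nat \<Rightarrow> real) \<Rightarrow> (complex \<Rightarrow> complex) \<Rightarrow> (complex \<Rightarrow> complex) \<Rightarrow> complex" where
  "dirichlet_inner lam beta f g =
     (\<Sum>n. dirichlet_coeffs lam beta f n * cnj (dirichlet_coeffs lam beta g n) *
            complex_of_real ((beta n)\<^sup>2))"

definition dirichlet_norm ::
    "(nat \<Rightarrow> real) \<Rightarrow> (nat \<Rightarrow> real) \<Rightarrow> (complex \<Rightarrow> complex) \<Rightarrow> real" where
  "dirichlet_norm lam beta f = sqrt (Re (dirichlet_inner lam beta f f))"

definition bounded_composition_operator ::
    "(nat \<Rightarrow> real) \<Rightarrow> (nat \<Rightarrow> real) \<Rightarrow> (complex \<Rightarrow> complex) \<Rightarrow> bool" where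
  "bounded_composition_operator lam beta \<phi> \<longleftrightarrow>
     \<phi> holomorphic_on half_plane (abscissa lam beta) \<and>
     \<phi> ` half_plane (abscissa lam beta) \<subseteq> half_plane (abscissa lam beta) \<and>
     (\<forall>f \<in> dirichlet_space lam beta. f \<circ> \<phi> \<in> dirichlet_space lam beta) \<and>
     (\<exists>C. \<forall>f \<in> dirichlet_space lam beta.
        dirichlet_norm lam beta (f \<circ> \<phi>) \<le> C * dirichlet_norm lam beta f)"

definition R_set :: "(nat \<Rightarrow> real) \<Rightarrow> real set" where
  "R_set lam = {r. r \<ge> 1 \<and> (\<forall>n. \<exists>m\<ge>n. r * lam n = lam m)}"

definition m_index :: "(nat \<Rightarrow> real) \<Rightarrow> real \<Rightarrow> nat \<Rightarrow> nat" where
  "m_index lam a n = (THE m. m \<ge> n \<and> a * lam n = lam m)"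

definition r_seq :: "(nat \<Rightarrow> real) \<Rightarrow> (nat \<Rightarrow> real) \<Rightarrow> real \<Rightarrow> real \<Rightarrow> nat \<Rightarrow> real" where
  "r_seq lam beta a x n = exp (- lam n * x) * (beta (m_index lam a n) / beta n)"

end

theory Submission
  imports Defs
begin

text \<open>
  Write \<open>\<sigma> = L/2 - \<beta>\<^sub>*\<close>. To the right of \<open>\<sigma>\<close> the numbers \<open>exp (- \<lambda>\<^sub>n x) / \<beta>\<^sub>n\<close> are square
  summable, so by Cauchy--Schwarz every coefficient sequence that is square summable against
  \<open>\<beta>\<^sup>2\<close> gives an absolutely convergent series there, and point evaluations are bounded
  (\<open>abs_convergence\<close>). Absolute convergence lets one read off the leading term of the series as
  \<open>z\<close> tends to infinity along the real axis (\<open>leading_term\<close>). This makes the coefficients unique,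
  so the norm is the weighted \<open>\<ell>\<^sup>2\<close> norm of the coefficients, and it shows that an exponential
  \<open>A exp (- \<mu> z)\<close> with \<open>A \<noteq> 0\<close> belongs to the space only if \<open>\<mu>\<close> is one of the frequencies
  (\<open>frequency_of_exponential\<close>).

  The necessity of the conditions comes from testing the operator on the monomials
  \<open>exp (- \<lambda>\<^sub>n z)\<close>. An affine map preserves a right half-plane only if its slope is real and
  non-negative and the map does not push the boundary line to the left
  (\<open>affine_half_plane\<close>). Since \<open>exp (- \<lambda>\<^sub>n (a z + b))\<close> is an exponential of frequency
  \<open>a \<lambda>\<^sub>n\<close>, multiplication by the slope maps frequencies to frequencies. A slope strictly between
  0 and 1 would then produce infinitely many frequencies below a given one, and a slope 0 would
  make 0 a frequency, which admits constant symbols only if the smallest frequency is 0. The number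
  \<open>r\<^sub>n\<close> is the factor by which the operator stretches the \<open>n\<close>-th monomial, so the \<open>r\<^sub>n\<close> are bounded.

  Conversely, constant symbols give a point evaluation followed by the embedding of the constants.
  For a symbol of the second kind, the operator moves the \<open>n\<close>-th coefficient to the position of
  \<open>a \<lambda>\<^sub>n\<close> and multiplies its contribution to the norm by \<open>r\<^sub>n\<close>; as different coefficients go to
  different positions, the operator norm is at most the supremum of the \<open>r\<^sub>n\<close>.
\<close>

section \<open>Square-summable sequences\<close>

lemma Cauchy_Schwarz_suminf:
  fixes f g :: "nat \<Rightarrow> real"
  assumes f: "summable (\<lambda>n. (f n)\<^sup>2)" and g: "summable (\<lambda>n. (g n)\<^sup>2)"
  shows "summable (\<lambda>n. \<bar>f n * g n\<bar>)"
    and "(\<Sum>n. \<bar>f n * g n\<bar>) \<le> sqrt (\<Sum>n. (f n)\<^sup>2) * sqrt (\<Sum>n. (g n)\<^sup>2)"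
proof -
  let ?B = "sqrt (\<Sum>n. (f n)\<^sup>2) * sqrt (\<Sum>n. (g n)\<^sup>2)"
  have partial: "(\<Sum>i<n. \<bar>f i * g i\<bar>) \<le> ?B" for n
  proof -
    have "(\<Sum>i<n. \<bar>f i * g i\<bar>) \<le> L2_set f {..<n} * L2_set g {..<n}"
      using L2_set_mult_ineq[of f g "{..<n}"] by (simp add: abs_mult)
    also have "\<dots> \<le> ?B"
      unfolding L2_set_def
      by (intro mult_mono real_sqrt_le_mono sum_le_suminf f g)
         (auto intro!: suminf_nonneg f g sum_nonneg)
    finally show ?thesis .
  qed
  show sm: "summable (\<lambda>n. \<bar>f n * g n\<bar>)"
    by (rule bounded_imp_summable[where B = ?B])
       (use partial[of "Suc _"] in \<open>auto simp: lessThan_Suc_atMost\<close>)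
  show "(\<Sum>n. \<bar>f n * g n\<bar>) \<le> ?B"
    by (rule suminf_le_const[OF sm partial])
qed

lemma summable_norm_diff_squared:
  fixes c d :: "nat \<Rightarrow> 'a :: real_normed_vector" and w :: "nat \<Rightarrow> real"
  assumes "summable (\<lambda>n. (norm (c n))\<^sup>2 * (w n)\<^sup>2)"
    and "summable (\<lambda>n. (norm (d n))\<^sup>2 * (w n)\<^sup>2)"
  shows "summable (\<lambda>n. (norm (c n - d n))\<^sup>2 * (w n)\<^sup>2)"
proof (rule summable_comparison_test')
  show "summable (\<lambda>n. 2 * ((norm (c n))\<^sup>2 * (w n)\<^sup>2 + (norm (d n))\<^sup>2 * (w n)\<^sup>2))"
    by (intro summable_mult summable_add assms)
  show "norm ((norm (c n - d n))\<^sup>2 * (w n)\<^sup>2)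
          \<le> 2 * ((norm (c n))\<^sup>2 * (w n)\<^sup>2 + (norm (d n))\<^sup>2 * (w n)\<^sup>2)" if "n \<ge> 0" for n
  proof -
    have "(norm (c n - d n))\<^sup>2 \<le> (norm (c n) + norm (d n))\<^sup>2"
      by (intro power_mono norm_triangle_ineq4) auto
    also have "\<dots> \<le> 2 * ((norm (c n))\<^sup>2 + (norm (d n))\<^sup>2)"
      using sum_squares_bound[of "norm (c n)" "norm (d n)"] by (simp add: power2_sum)
    finally show ?thesis
      using mult_right_mono[of _ _ "(w n)\<^sup>2"] by (fastforce simp: algebra_simps)
  qed
qed

section \<open>Affine self-maps of a half-plane\<close>

text \<open>
  A non-real slope would tilt vertical lines, and a negative slope would reverse horizontal rays;
  both leave every right half-plane. The bound on \<open>b\<close> says that the boundary line is mapped into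
  the closed half-plane.
\<close>

lemma affine_half_plane:
  assumes maps: "(\<lambda>z. a * z + b) ` half_plane s \<subseteq> half_plane s"
  obtains r where "r \<ge> 0" "a = complex_of_real r" "Re b \<ge> (1 - r) * s"
proof -
  have gt: "Re a * x - Im a * t + Re b > s" if "x > s" for x t
  proof -
    have "Complex x t \<in> half_plane s" using that by (simp add: half_plane_def)
    then have "a * Complex x t + b \<in> half_plane s" using maps by blast
    then show ?thesis by (simp add: half_plane_def)
  qed
  have im: "Im a = 0"
  proof (rule ccontr)
    assume "Im a \<noteq> 0"
    \<comment> \<open>This point of the vertical line over \<open>s + 1\<close> is sent to the boundary line.\<close>
    then show False
      using gt[of "s + 1" "(Re a * (s + 1) + Re b - s) / Im a"] by simp
  qed
  have re: "Re a \<ge> 0"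
  proof (rule ccontr)
    assume neg: "\<not> Re a \<ge> 0"
    let ?x = "max (s + 1) ((s - Re b) / Re a)"
    have "Re a * ?x \<le> Re a * ((s - Re b) / Re a)"
      using neg by (intro mult_left_mono_neg) auto
    also have "\<dots> = s - Re b" using neg by simp
    finally show False using gt[of ?x 0] by (simp add: im less_max_iff_disj)
  qed
  have "s \<le> Re a * s + Re b + e" if "e > 0" for e
  proof -
    have "Re a * (e / (Re a + 1)) \<le> e"
      using re that by (simp add: field_simps)
    moreover have "e / (Re a + 1) > 0" using re that by simp
    ultimately show ?thesis
      using gt[of "s + e / (Re a + 1)" 0] by (simp add: im distrib_left)
  qed
  then have "s \<le> Re a * s + Re b" by (rule field_le_epsilon)
  then show ?thesis
    using that[of "Re a"] re im by (simp add: complex_eq_iff algebra_simps)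
qed

section \<open>Convergence and uniqueness in the weighted space\<close>

locale weighted_frequencies =
  fixes lam beta :: "nat \<Rightarrow> real"
  assumes lam_strict: "strict_mono lam"
    and lam_nonneg: "\<And>n. lam n \<ge> 0"
    and lam_top: "filterlim lam at_top sequentially"
    and L_finite: "L_sup lam < \<infinity>"
    and beta_pos: "\<And>n. beta n > 0"
    and beta_star_PInf: "beta_star lam beta \<noteq> \<infinity>"
    and beta_star_MInf: "beta_star lam beta \<noteq> - \<infinity>"
begin

abbreviation "\<sigma> \<equiv> abscissa lam beta"

lemma lam_eq_iff [simp]: "lam m = lam n \<longleftrightarrow> m = n"
  using lam_strict by (simp add: strict_mono_eq)

text \<open>
  For large \<open>n\<close> and up to an arbitrarily small change of \<open>\<beta>\<^sub>*\<close> and \<open>L\<close>, \<open>\<beta>\<^sub>n\<close> is at least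
  \<open>exp (\<beta>\<^sub>* \<lambda>\<^sub>n)\<close> and \<open>ln n\<close> is at most \<open>L \<lambda>\<^sub>n\<close>. For \<open>x > L/2 - \<beta>\<^sub>*\<close> the terms are therefore dominated by \<open>n\<close> to a power smaller
  than -1.
\<close>

lemma summable_kernel:
  assumes x: "x > \<sigma>"
  shows "summable (\<lambda>n. (exp (- lam n * x) / beta n)\<^sup>2)"
proof -
  define L where "L = real_of_ereal (L_sup lam)"
  define B where "B = real_of_ereal (beta_star lam beta)"
  define d where "d = x + B - L / 2"
  have "d > 0" using x by (simp add: d_def abscissa_def L_def B_def)
  have ratio_nonneg: "0 \<le> ln (real (Suc n)) / lam n" for n
    using lam_nonneg[of n] by simp
  have "0 \<le> L_sup lam"
    unfolding L_sup_def
    by (rule le_Limsup) (use ratio_nonneg in auto)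
  then have L: "L_sup lam = ereal L" "L \<ge> 0"
    using L_finite unfolding L_def by (cases "L_sup lam"; auto)+
  have B: "beta_star lam beta = ereal B"
    using beta_star_PInf beta_star_MInf unfolding B_def by (cases "beta_star lam beta") auto
  \<comment> \<open>The gap \<open>d\<close> pays both for the error in the limit superior and for that in the limit inferior.\<close>
  have "L_sup lam < ereal (L + d / 2)" using L \<open>d > 0\<close> by simp
  then have ev_L: "\<forall>\<^sub>F n in sequentially. ln (real (Suc n)) / lam n < L + d / 2"
    unfolding L_sup_def by (auto dest!: Limsup_lessD)
  have "ereal (B - d / 2) < beta_star lam beta" using B \<open>d > 0\<close> by simp
  then have ev_B: "\<forall>\<^sub>F n in sequentially. B - d / 2 < ln (beta n) / lam n"
    unfolding beta_star_def by (auto dest!: less_LiminfD)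
  define p where "p = (L + d) / (L + d / 2)"
  have "p > 1" using L \<open>d > 0\<close> by (simp add: p_def field_simps)
  have "\<forall>\<^sub>F n in sequentially.
          norm ((exp (- lam n * x) / beta n)\<^sup>2) \<le> real (Suc n) powr (- p)"
    using ev_L ev_B lam_top[unfolded filterlim_at_top_dense, rule_format, of 0]
  proof eventually_elim
    case (elim n)
    have "(B - d / 2) * lam n \<le> ln (beta n)"
      using elim by (simp add: field_simps)
    then have "- 2 * lam n * x - 2 * ln (beta n) \<le> - 2 * lam n * x - 2 * ((B - d / 2) * lam n)"
      by simp
    also have "\<dots> = - ((2 * x + 2 * B - d) * lam n)" by (simp add: algebra_simps)
    also have "2 * x + 2 * B - d = L + d" by (simp add: d_def)
    finally have "- 2 * lam n * x - 2 * ln (beta n) \<le> - ((L + d) * lam n)" .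
    moreover have "p * ln (real (Suc n)) \<le> (L + d) * lam n"
    proof -
      have "ln (real (Suc n)) \<le> (L + d / 2) * lam n"
        using elim by (simp add: field_simps)
      then have "p * ln (real (Suc n)) \<le> p * ((L + d / 2) * lam n)"
        using \<open>p > 1\<close> by (intro mult_left_mono) auto
      also have "\<dots> = (L + d) * lam n"
        using L \<open>d > 0\<close> by (simp add: p_def)
      finally show ?thesis .
    qed
    ultimately have "exp (- 2 * lam n * x - 2 * ln (beta n)) \<le> exp (- (p * ln (real (Suc n))))"
      unfolding exp_le_cancel_iff by linarith
    moreover have "(exp (- lam n * x) / beta n)\<^sup>2 = exp (- 2 * lam n * x - 2 * ln (beta n))"
    proof -
      have "exp (- lam n * x) / beta n = exp (- lam n * x - ln (beta n))"
        using beta_pos[of n] by (simp add: exp_diff)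
      then show ?thesis by (simp add: exp_double[symmetric] algebra_simps)
    qed
    ultimately show ?case by (simp add: powr_def)
  qed
  moreover have "summable (\<lambda>n. real (Suc n) powr (- p))"
    using \<open>p > 1\<close> summable_Suc_iff[of "\<lambda>n. real n powr (- p)"]
    by (simp add: summable_real_powr_iff)
  ultimately show ?thesis by (rule summable_comparison_test_ev)
qed

text \<open>
  Cauchy--Schwarz pairs \<open>c\<^sub>n \<beta>\<^sub>n\<close> with \<open>exp (- \<lambda>\<^sub>n x) / \<beta>\<^sub>n\<close>. The second part becomes the
  boundedness of point evaluations once the norm is known to be the weighted \<open>\<ell>\<^sup>2\<close> norm of the
  coefficients.
\<close>

lemma abs_convergence:
  assumes c: "summable (\<lambda>n. (cmod (c n))\<^sup>2 * (beta n)\<^sup>2)" and z: "z \<in> half_plane \<sigma>"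
  shows "summable (\<lambda>n. cmod (c n * exp (- complex_of_real (lam n) * z)))" (is "summable ?t")
    and "cmod (\<Sum>n. c n * exp (- complex_of_real (lam n) * z))
           \<le> sqrt (\<Sum>n. (cmod (c n))\<^sup>2 * (beta n)\<^sup>2)
             * sqrt (\<Sum>n. (exp (- lam n * Re z) / beta n)\<^sup>2)"
proof -
  have c': "summable (\<lambda>n. (cmod (c n) * beta n)\<^sup>2)"
    using c by (simp add: power_mult_distrib)
  have k: "summable (\<lambda>n. (exp (- lam n * Re z) / beta n)\<^sup>2)"
    using z by (intro summable_kernel) (simp add: half_plane_def)
  have pairing: "\<bar>cmod (c n) * beta n * (exp (- lam n * Re z) / beta n)\<bar> = ?t n" for n
    using beta_pos[of n] by (simp add: norm_mult abs_mult)
  note CS = Cauchy_Schwarz_suminf[OF c' k, unfolded pairing]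
  show sm: "summable ?t" by (rule CS(1))
  have "cmod (\<Sum>n. c n * exp (- complex_of_real (lam n) * z)) \<le> suminf ?t"
    by (rule summable_norm[OF sm])
  with CS(2) show "cmod (\<Sum>n. c n * exp (- complex_of_real (lam n) * z))
           \<le> sqrt (\<Sum>n. (cmod (c n))\<^sup>2 * (beta n)\<^sup>2)
             * sqrt (\<Sum>n. (exp (- lam n * Re z) / beta n)\<^sup>2)"
    by (simp add: power_mult_distrib)
qed

text \<open>
  After multiplication by \<open>exp (\<lambda>\<^sub>m x)\<close>, where \<open>m\<close> is the first index with \<open>c\<^sub>m \<noteq> 0\<close>, every
  other term tends to 0 as \<open>x\<close> grows; absolute convergence at the single point \<open>\<sigma> + 1\<close> supplies a
  majorant that is uniform in \<open>x \<ge> \<sigma> + 1\<close>.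
\<close>

lemma leading_term:
  assumes f: "is_coeffs lam beta f c" and nz: "c k \<noteq> 0"
  obtains m where "c m \<noteq> 0"
    and "((\<lambda>x. complex_of_real (exp (lam m * x)) * f (complex_of_real x)) \<longlongrightarrow> c m) at_top"
proof -
  define m where "m = (LEAST n. c n \<noteq> 0)"
  have cm: "c m \<noteq> 0" unfolding m_def using nz by (rule LeastI)
  have below: "c n = 0" if "n < m" for n
    using not_less_Least[of n "\<lambda>n. c n \<noteq> 0"] that by (auto simp: m_def)
  define t where "t n x = c n * complex_of_real (exp ((lam m - lam n) * x))" for n x
  have t_lim: "((\<lambda>x. t n x) \<longlongrightarrow> (if n = m then c n else 0)) at_top" for n
  proof (cases "n \<le> m")
    case True
    then show ?thesis using below[of n] by (cases "n = m") (auto simp: t_def)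
  next
    case False
    then have "lam m - lam n < 0"
      using lam_strict by (auto simp: strict_mono_def)
    then have "((\<lambda>x. exp ((lam m - lam n) * x)) \<longlongrightarrow> 0) at_top"
      by (intro filterlim_compose[OF exp_at_bot] filterlim_tendsto_neg_mult_at_bot[OF tendsto_const])
         (auto simp: filterlim_ident)
    then have "((\<lambda>x. t n x) \<longlongrightarrow> c n * complex_of_real 0) at_top"
      unfolding t_def by (intro tendsto_intros)
    with False show ?thesis by simp
  qed
  let ?M = "\<lambda>n. exp (lam m * (\<sigma> + 1)) *
                cmod (c n * exp (- complex_of_real (lam n) * complex_of_real (\<sigma> + 1)))"
  have M: "summable ?M"
    using f by (intro summable_mult abs_convergence) (auto simp: is_coeffs_def half_plane_def)
  have "cmod (t n x) \<le> ?M n" if "x \<ge> \<sigma> + 1" for n x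
  proof (cases "n < m")
    case True
    then show ?thesis by (simp add: t_def below)
  next
    case False
    then have "lam m - lam n \<le> 0" using lam_strict by (simp add: strict_mono_less_eq)
    then have "(lam m - lam n) * x \<le> (lam m - lam n) * (\<sigma> + 1)"
      using that by (intro mult_left_mono_neg) auto
    then have "exp ((lam m - lam n) * x) \<le> exp (lam m * (\<sigma> + 1)) * exp (- lam n * (\<sigma> + 1))"
      by (simp add: exp_add[symmetric] algebra_simps)
    then have "cmod (c n) * exp ((lam m - lam n) * x)
                 \<le> cmod (c n) * (exp (lam m * (\<sigma> + 1)) * exp (- lam n * (\<sigma> + 1)))"
      by (intro mult_left_mono) auto
    then show ?thesis by (simp add: t_def norm_mult mult_ac)
  qed
  then have "\<forall>\<^sub>F (n, x) in at_top \<times>\<^sub>F at_top. cmod (t n x) \<le> ?M n"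
    unfolding eventually_prod_filter
    by (intro exI[of _ "\<lambda>_. True"] exI[of _ "\<lambda>x. x \<ge> \<sigma> + 1"]) (auto simp: eventually_ge_at_top)
  from tannerys_theorem[OF t_lim this M]
  have "((\<lambda>x. \<Sum>n. t n x) \<longlongrightarrow> (\<Sum>n. if n = m then c n else 0)) at_top"
    by simp
  also have "(\<Sum>n. if n = m then c n else 0) = c m"
    using sums_single[of m c] by (rule sums_unique[symmetric])
  finally have lim: "((\<lambda>x. \<Sum>n. t n x) \<longlongrightarrow> c m) at_top" .
  have "\<forall>\<^sub>F x in at_top. (\<Sum>n. t n x) = complex_of_real (exp (lam m * x)) * f (complex_of_real x)"
    using eventually_gt_at_top[of \<sigma>]
  proof eventually_elim
    case (elim x)
    have "(\<lambda>n. c n * exp (- complex_of_real (lam n) * complex_of_real x)) sums f (complex_of_real x)"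
      using f elim by (auto simp: is_coeffs_def half_plane_def)
    from sums_mult[OF this, of "complex_of_real (exp (lam m * x))"]
    have "(\<lambda>n. t n x) sums (complex_of_real (exp (lam m * x)) * f (complex_of_real x))"
      by (simp add: t_def exp_of_real[symmetric] exp_diff exp_minus algebra_simps divide_inverse)
    then show ?case by (rule sums_unique[symmetric])
  qed
  then have "((\<lambda>x. complex_of_real (exp (lam m * x)) * f (complex_of_real x)) \<longlongrightarrow> c m) at_top"
    using lim by (rule Lim_transform_eventually[rotated])
  with cm show ?thesis by (rule that)
qed

lemma is_coeffs_unique:
  assumes c: "is_coeffs lam beta f c" and d: "is_coeffs lam beta f d"
  shows "c = d"
proof (rule ccontr)
  assume "c \<noteq> d"
  then obtain k where k: "c k - d k \<noteq> 0" by fastforce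
  have "is_coeffs lam beta (\<lambda>_. 0) (\<lambda>n. c n - d n)"
    unfolding is_coeffs_def
  proof (intro conjI ballI)
    show "summable (\<lambda>n. (cmod (c n - d n))\<^sup>2 * (beta n)\<^sup>2)"
      using c d by (intro summable_norm_diff_squared) (auto simp: is_coeffs_def)
    fix z assume "z \<in> half_plane \<sigma>"
    then have "(\<lambda>n. c n * exp (- complex_of_real (lam n) * z)
                  - d n * exp (- complex_of_real (lam n) * z)) sums (f z - f z)"
      using c d by (intro sums_diff) (auto simp: is_coeffs_def)
    then show "(\<lambda>n. (c n - d n) * exp (- complex_of_real (lam n) * z)) sums 0"
      by (simp add: left_diff_distrib)
  qed
  from leading_term[OF this k] obtain m where
    m: "c m - d m \<noteq> 0" "((\<lambda>x::real. 0 :: complex) \<longlongrightarrow> c m - d m) at_top"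
    by auto
  then show False using tendsto_unique[OF _ m(2) tendsto_const] by simp
qed

lemma dirichlet_norm_eq:
  assumes "is_coeffs lam beta f c"
  shows "dirichlet_norm lam beta f = sqrt (\<Sum>n. (cmod (c n))\<^sup>2 * (beta n)\<^sup>2)"
proof -
  have "dirichlet_coeffs lam beta f = c"
    unfolding dirichlet_coeffs_def using assms is_coeffs_unique by (intro the_equality)
  then have "dirichlet_inner lam beta f f
               = (\<Sum>n. complex_of_real ((cmod (c n))\<^sup>2 * (beta n)\<^sup>2))"
    unfolding dirichlet_inner_def by (simp only: of_real_mult complex_norm_square)
  also have "\<dots> = complex_of_real (\<Sum>n. (cmod (c n))\<^sup>2 * (beta n)\<^sup>2)"
    using assms by (intro suminf_of_real[symmetric]) (simp add: is_coeffs_def)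
  finally show ?thesis by (simp add: dirichlet_norm_def)
qed

section \<open>Exponentials in the weighted space\<close>

lemma is_coeffs_monomial:
  assumes g: "\<And>z. z \<in> half_plane \<sigma> \<Longrightarrow> g z = A * exp (- complex_of_real (lam m) * z)"
  shows "is_coeffs lam beta g (\<lambda>n. if n = m then A else 0)"
  unfolding is_coeffs_def
proof (intro conjI ballI)
  have "(\<lambda>n. if n = m then (cmod A)\<^sup>2 * (beta n)\<^sup>2 else 0) sums ((cmod A)\<^sup>2 * (beta m)\<^sup>2)"
    by (rule sums_single)
  then show "summable (\<lambda>n. (cmod (if n = m then A else 0))\<^sup>2 * (beta n)\<^sup>2)"
    by (auto simp: sums_iff if_distrib if_distribR cong: if_cong)
  fix z assume "z \<in> half_plane \<sigma>"
  then show "(\<lambda>n. (if n = m then A else 0) * exp (- complex_of_real (lam n) * z)) sums g z"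
    using sums_single[of m "\<lambda>n. A * exp (- complex_of_real (lam n) * z)"]
    by (simp add: g if_distrib if_distribR cong: if_cong)
qed

lemma dirichlet_norm_monomial:
  assumes "\<And>z. z \<in> half_plane \<sigma> \<Longrightarrow> g z = A * exp (- complex_of_real (lam m) * z)"
  shows "dirichlet_norm lam beta g = cmod A * beta m"
proof -
  have "(\<lambda>n. (cmod (if n = m then A else 0))\<^sup>2 * (beta n)\<^sup>2) sums ((cmod A)\<^sup>2 * (beta m)\<^sup>2)"
    using sums_single[of m "\<lambda>n. (cmod A)\<^sup>2 * (beta n)\<^sup>2"]
    by (simp add: if_distrib if_distribR cong: if_cong)
  then show ?thesis
    using beta_pos[of m] dirichlet_norm_eq[OF is_coeffs_monomial[OF assms]]
    by (simp add: sums_iff real_sqrt_mult)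
qed

text \<open>
  Both the exponential and its Dirichlet series have a precise rate of decay along the real axis:
  \<open>exp (- \<mu> x)\<close> for the former, \<open>exp (- \<lambda>\<^sub>m x)\<close> with some \<open>m\<close> for the latter.
\<close>

lemma frequency_of_exponential:
  assumes g: "g \<in> dirichlet_space lam beta" and A: "A \<noteq> 0"
    and eq: "\<And>z. z \<in> half_plane \<sigma> \<Longrightarrow> g z = A * exp (- complex_of_real \<mu> * z)"
  obtains m where "lam m = \<mu>"
proof -
  from g obtain c where c: "is_coeffs lam beta g c" by (auto simp: dirichlet_space_def)
  have "\<exists>k. c k \<noteq> 0"
  proof (rule ccontr)
    assume zero: "\<not> (\<exists>k. c k \<noteq> 0)"
    let ?z = "complex_of_real (\<sigma> + 1)"
    have z: "?z \<in> half_plane \<sigma>" by (simp add: half_plane_def)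
    then have "(\<lambda>n. c n * exp (- complex_of_real (lam n) * ?z)) sums g ?z"
      using c unfolding is_coeffs_def by blast
    then have "(\<lambda>n. 0) sums g ?z" using zero by simp
    then have "g ?z = 0" by (simp add: sums_iff)
    with eq[OF z] A show False by simp
  qed
  then obtain k where "c k \<noteq> 0" by blast
  from leading_term[OF c this] obtain m where m: "c m \<noteq> 0"
    and lim: "((\<lambda>x. complex_of_real (exp (lam m * x)) * g (complex_of_real x)) \<longlongrightarrow> c m) at_top" .
  have "\<forall>\<^sub>F x in at_top. cmod (complex_of_real (exp (lam m * x)) * g (complex_of_real x)) / cmod A
                          = exp ((lam m - \<mu>) * x)"
    using eventually_gt_at_top[of \<sigma>]
  proof eventually_elim
    case (elim x)
    then have "g (complex_of_real x) = A * exp (- complex_of_real \<mu> * complex_of_real x)"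
      by (intro eq) (simp add: half_plane_def)
    also have "exp (- complex_of_real \<mu> * complex_of_real x) = complex_of_real (exp (- \<mu> * x))"
      by (simp add: exp_of_real[symmetric])
    finally show ?case
      using A by (simp add: norm_mult left_diff_distrib exp_diff exp_minus divide_inverse norm_inverse)
  qed
  moreover have "((\<lambda>x. cmod (complex_of_real (exp (lam m * x)) * g (complex_of_real x)) / cmod A)
                   \<longlongrightarrow> cmod (c m) / cmod A) at_top"
    using A by (intro tendsto_intros lim) auto
  ultimately have exp_lim: "((\<lambda>x. exp ((lam m - \<mu>) * x)) \<longlongrightarrow> cmod (c m) / cmod A) at_top"
    by (rule Lim_transform_eventually[rotated])
  have "lam m = \<mu>"
  proof (cases "lam m" \<mu> rule: linorder_cases)
    case less
    then have "((\<lambda>x. exp ((lam m - \<mu>) * x)) \<longlongrightarrow> 0) at_top"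
      by (intro filterlim_compose[OF exp_at_bot] filterlim_tendsto_neg_mult_at_bot[OF tendsto_const])
         (auto simp: filterlim_ident)
    with exp_lim have "cmod (c m) / cmod A = 0"
      by (intro tendsto_unique[OF trivial_limit_at_top_linorder])
    then show ?thesis using m A by simp
  next
    case greater
    then have "filterlim (\<lambda>x. exp ((lam m - \<mu>) * x)) at_top at_top"
      by (intro filterlim_compose[OF exp_at_top] filterlim_tendsto_pos_mult_at_top[OF tendsto_const])
         (auto simp: filterlim_ident)
    then show ?thesis
      using not_tendsto_and_filterlim_at_infinity[OF _ exp_lim] filterlim_at_top_imp_at_infinity
      by auto
  qed
  then show ?thesis by (rule that)
qed

section \<open>Multipliers of the frequencies\<close>

text \<open>
  Iterating a factor below 1 would send a positive frequency to ever smaller positive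
  frequencies, but the frequencies are well-ordered.
\<close>

lemma multiplier_ge_1:
  assumes r: "r > 0" and mult: "\<And>n. \<exists>m. r * lam n = lam m"
  shows "r \<ge> 1"
proof (rule ccontr)
  assume "\<not> r \<ge> 1"
  have pos: "lam n > 0" if "n \<ge> 1" for n
  proof -
    have "lam 0 < lam n" using lam_strict that by (simp add: strict_mono_less)
    then show ?thesis using lam_nonneg[of 0] by linarith
  qed
  have descent: "\<not> lam n > 0" for n
  proof (induction n rule: less_induct)
    case (less n)
    show ?case
    proof
      assume n: "lam n > 0"
      obtain m where m: "r * lam n = lam m" using mult by blast
      have "lam m < lam n" using m n \<open>\<not> r \<ge> 1\<close> by (simp flip: m)
      then have "m < n" using lam_strict by (simp add: strict_mono_less)
      moreover have "lam m > 0" using n r by (simp flip: m)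
      ultimately show False using less by blast
    qed
  qed
  then show False using pos[of 1] by blast
qed

lemma multiplier_in_R_set:
  assumes "r > 0" and mult: "\<And>n. \<exists>m. r * lam n = lam m"
  shows "r \<in> R_set lam"
proof -
  have r: "r \<ge> 1" using assms by (rule multiplier_ge_1)
  have "\<exists>m\<ge>n. r * lam n = lam m" for n
  proof -
    obtain m where m: "r * lam n = lam m" using mult by blast
    have "lam n \<le> lam m"
      using m[symmetric] r lam_nonneg[of n] mult_right_mono[of 1 r "lam n"] by simp
    then have "n \<le> m" using lam_strict by (simp add: strict_mono_less_eq)
    with m show ?thesis by blast
  qed
  with r show ?thesis by (simp add: R_set_def)
qed

lemma lam_m_index:
  assumes "r \<in> R_set lam"
  shows "lam (m_index lam r n) = r * lam n"
proof -
  obtain m where "m \<ge> n" "r * lam n = lam m" using assms by (auto simp: R_set_def)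
  then have "m_index lam r n = m"
    unfolding m_index_def by (intro the_equality) auto
  with \<open>r * lam n = lam m\<close> show ?thesis by simp
qed

lemma strict_mono_m_index:
  assumes "r \<in> R_set lam"
  shows "strict_mono (m_index lam r)"
proof (rule strict_monoI)
  fix i j :: nat assume "i < j"
  then have "r * lam i < r * lam j"
    using assms lam_strict by (auto simp: R_set_def strict_mono_less)
  then show "m_index lam r i < m_index lam r j"
    using strict_mono_less[OF lam_strict, of "m_index lam r i" "m_index lam r j"]
    by (simp add: lam_m_index[OF assms])
qed

section \<open>Sufficiency\<close>

lemma bounded_composition_constant:
  assumes lam0: "lam 0 = 0" and b: "Re b > \<sigma>"
  shows "bounded_composition_operator lam beta (\<lambda>z. 0 * z + b)"
proof -
  have b': "b \<in> half_plane \<sigma>" using b by (simp add: half_plane_def)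
  have const: "(f \<circ> (\<lambda>z. 0 * z + b)) z = f b * exp (- complex_of_real (lam 0) * z)" for f z
    by (simp add: lam0)
  have "f \<circ> (\<lambda>z. 0 * z + b) \<in> dirichlet_space lam beta" for f
    using is_coeffs_monomial[of _ _ 0, OF const] by (auto simp: dirichlet_space_def)
  moreover have "dirichlet_norm lam beta (f \<circ> (\<lambda>z. 0 * z + b))
          \<le> (beta 0 * sqrt (\<Sum>n. (exp (- lam n * Re b) / beta n)\<^sup>2)) * dirichlet_norm lam beta f"
    if "f \<in> dirichlet_space lam beta" for f
  proof -
    from that obtain c where c: "is_coeffs lam beta f c" by (auto simp: dirichlet_space_def)
    have "f b = (\<Sum>n. c n * exp (- complex_of_real (lam n) * b))"
      using c b' unfolding is_coeffs_def by (intro sums_unique) blast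
    also have "cmod \<dots> \<le> dirichlet_norm lam beta f
                 * sqrt (\<Sum>n. (exp (- lam n * Re b) / beta n)\<^sup>2)"
      unfolding dirichlet_norm_eq[OF c]
      using c by (intro abs_convergence(2) b') (simp add: is_coeffs_def)
    finally have "cmod (f b) * beta 0 \<le> dirichlet_norm lam beta f
                 * sqrt (\<Sum>n. (exp (- lam n * Re b) / beta n)\<^sup>2) * beta 0"
      using beta_pos[of 0] by (intro mult_right_mono) auto
    then show ?thesis
      by (subst dirichlet_norm_monomial[of _ _ 0, OF const]) (simp add: mult_ac)
  qed
  moreover have "(\<lambda>z. 0 * z + b) holomorphic_on half_plane \<sigma>"
    by (intro holomorphic_intros)
  moreover have "(\<lambda>z. 0 * z + b) ` half_plane \<sigma> \<subseteq> half_plane \<sigma>"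
    using b' by auto
  ultimately show ?thesis unfolding bounded_composition_operator_def by blast
qed

text \<open>
  The coefficients of \<open>f \<circ> \<phi>\<close> for \<open>\<phi> z = r z + b\<close>, because
  \<open>exp (- \<lambda>\<^sub>n (r z + b)) = exp (- \<lambda>\<^sub>n b) exp (- (r \<lambda>\<^sub>n) z)\<close>.
\<close>

definition moved_coeffs :: "real \<Rightarrow> complex \<Rightarrow> (nat \<Rightarrow> complex) \<Rightarrow> nat \<Rightarrow> complex" where
  "moved_coeffs r b c k =
     (if k \<in> range (m_index lam r)
      then c (inv (m_index lam r) k) * exp (- complex_of_real (lam (inv (m_index lam r) k)) * b)
      else 0)"

lemma moved_coeffs_m_index:
  assumes "r \<in> R_set lam"
  shows "moved_coeffs r b c (m_index lam r n) = c n * exp (- complex_of_real (lam n) * b)"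
  using strict_mono_imp_inj_on[OF strict_mono_m_index[OF assms]]
  by (simp add: moved_coeffs_def)

lemma moved_coeffs_weight:
  assumes "r \<in> R_set lam"
  shows "(cmod (moved_coeffs r b c (m_index lam r n)))\<^sup>2 * (beta (m_index lam r n))\<^sup>2
         = (r_seq lam beta r (Re b) n)\<^sup>2 * ((cmod (c n))\<^sup>2 * (beta n)\<^sup>2)"
  using beta_pos[of n]
  by (simp add: moved_coeffs_m_index[OF assms] r_seq_def norm_mult power_mult_distrib power_divide)

lemma bounded_composition_affine:
  assumes r: "r \<in> R_set lam" and b: "Re b \<ge> (1 - r) * \<sigma>"
    and bdd: "bounded (range (r_seq lam beta r (Re b)))"
  shows "bounded_composition_operator lam beta (\<lambda>z. complex_of_real r * z + b)"
    (is "bounded_composition_operator _ _ ?\<phi>")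
proof -
  let ?m = "m_index lam r" and ?w = "r_seq lam beta r (Re b)"
  have "r \<ge> 1" using r by (simp add: R_set_def)
  have maps: "?\<phi> z \<in> half_plane \<sigma>" if "z \<in> half_plane \<sigma>" for z
  proof -
    have "r * \<sigma> < r * Re z"
      using that \<open>r \<ge> 1\<close> by (simp add: half_plane_def)
    then show ?thesis using b by (simp add: half_plane_def algebra_simps)
  qed
  obtain C where C: "C > 0" "\<And>n. \<bar>?w n\<bar> \<le> C"
    using bdd by (auto simp: bounded_pos)
  have image: "f \<circ> ?\<phi> \<in> dirichlet_space lam beta \<and>
               dirichlet_norm lam beta (f \<circ> ?\<phi>) \<le> C * dirichlet_norm lam beta f"
    if "f \<in> dirichlet_space lam beta" for f
  proof -
    from that obtain c where c: "is_coeffs lam beta f c" by (auto simp: dirichlet_space_def)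
    let ?d = "moved_coeffs r b c"
    let ?W = "\<lambda>n. (cmod (c n))\<^sup>2 * (beta n)\<^sup>2"
    have W: "summable ?W" using c by (simp add: is_coeffs_def)
    have d_off: "?d k = 0" if "k \<notin> range ?m" for k
      using that by (simp add: moved_coeffs_def)
    have le: "(?w n)\<^sup>2 * ?W n \<le> C\<^sup>2 * ?W n" for n
      using C(2)[of n] C(1) by (intro mult_right_mono) (auto simp: abs_le_square_iff[symmetric])
    have sm: "summable (\<lambda>n. (?w n)\<^sup>2 * ?W n)"
      by (rule summable_comparison_test'[OF summable_mult[OF W, of "C\<^sup>2"]])
         (use le in \<open>auto simp: abs_mult\<close>)
    have "(\<lambda>n. (?w n)\<^sup>2 * ?W n) sums (\<Sum>n. (?w n)\<^sup>2 * ?W n)"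
      using sm by (rule summable_sums)
    then have "(\<lambda>n. (cmod (?d (?m n)))\<^sup>2 * (beta (?m n))\<^sup>2) sums (\<Sum>n. (?w n)\<^sup>2 * ?W n)"
      by (simp only: moved_coeffs_weight[OF r])
    then have d_sums: "(\<lambda>k. (cmod (?d k))\<^sup>2 * (beta k)\<^sup>2) sums (\<Sum>n. (?w n)\<^sup>2 * ?W n)"
      by (subst (asm) sums_mono_reindex[OF strict_mono_m_index[OF r]]) (simp_all add: d_off)
    have d: "is_coeffs lam beta (f \<circ> ?\<phi>) ?d"
      unfolding is_coeffs_def
    proof (intro conjI ballI)
      show "summable (\<lambda>k. (cmod (?d k))\<^sup>2 * (beta k)\<^sup>2)" using d_sums by (rule sums_summable)
      fix z assume "z \<in> half_plane \<sigma>"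
      then have "(\<lambda>n. c n * exp (- complex_of_real (lam n) * ?\<phi> z)) sums f (?\<phi> z)"
        using c maps unfolding is_coeffs_def by blast
      also have "(\<lambda>n. c n * exp (- complex_of_real (lam n) * ?\<phi> z))
                   = (\<lambda>n. ?d (?m n) * exp (- complex_of_real (lam (?m n)) * z))"
        by (simp add: moved_coeffs_m_index[OF r] lam_m_index[OF r] exp_add[symmetric]
            mult.assoc algebra_simps)
      finally show "(\<lambda>k. ?d k * exp (- complex_of_real (lam k) * z)) sums (f \<circ> ?\<phi>) z"
        by (subst (asm) sums_mono_reindex[OF strict_mono_m_index[OF r],
              where f = "\<lambda>k. ?d k * exp (- complex_of_real (lam k) * z)"])
           (simp_all add: d_off)
    qed
    have "(\<Sum>n. (?w n)\<^sup>2 * ?W n) \<le> C\<^sup>2 * suminf ?W"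
      using suminf_le[OF le sm summable_mult[OF W]] suminf_mult[OF W] by simp
    then have "dirichlet_norm lam beta (f \<circ> ?\<phi>) \<le> sqrt (C\<^sup>2 * suminf ?W)"
      using d_sums by (simp add: dirichlet_norm_eq[OF d] sums_iff)
    also have "\<dots> = C * dirichlet_norm lam beta f"
      using C(1) by (simp add: dirichlet_norm_eq[OF c] real_sqrt_mult)
    finally show ?thesis using d by (auto simp: dirichlet_space_def)
  qed
  have "?\<phi> holomorphic_on half_plane \<sigma>"
    by (intro holomorphic_intros)
  moreover have "?\<phi> ` half_plane \<sigma> \<subseteq> half_plane \<sigma>"
    using maps by blast
  ultimately show ?thesis
    unfolding bounded_composition_operator_def using image by blast
qed

section \<open>Necessity\<close>

lemma monomial_in_space: "(\<lambda>z. exp (- complex_of_real (lam n) * z)) \<in> dirichlet_space lam beta"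
  unfolding dirichlet_space_def
  using is_coeffs_monomial[of "\<lambda>z. exp (- complex_of_real (lam n) * z)" 1 n] by auto

lemma monomial_comp_affine:
  "((\<lambda>z. exp (- complex_of_real (lam n) * z)) \<circ> (\<lambda>z. complex_of_real r * z + b)) z
     = exp (- complex_of_real (lam n) * b) * exp (- complex_of_real (r * lam n) * z)"
  by (simp add: exp_add[symmetric] algebra_simps)

lemma bounded_composition_frequencies:
  assumes "bounded_composition_operator lam beta (\<lambda>z. complex_of_real r * z + b)"
  shows "\<exists>m. r * lam n = lam m"
proof -
  have "(\<lambda>z. exp (- complex_of_real (lam n) * z)) \<circ> (\<lambda>z. complex_of_real r * z + b)
          \<in> dirichlet_space lam beta"
    using assms monomial_in_space unfolding bounded_composition_operator_def by blast
  from frequency_of_exponential[OF this _ monomial_comp_affine] show ?thesis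
    by (metis exp_not_eq_zero)
qed

lemma bounded_composition_r_seq:
  assumes bc: "bounded_composition_operator lam beta (\<lambda>z. complex_of_real r * z + b)"
    and r: "r \<in> R_set lam"
  shows "bounded (range (r_seq lam beta r (Re b)))"
proof -
  from bc obtain C where
    C: "\<And>f. f \<in> dirichlet_space lam beta \<Longrightarrow>
      dirichlet_norm lam beta (f \<circ> (\<lambda>z. complex_of_real r * z + b)) \<le> C * dirichlet_norm lam beta f"
    unfolding bounded_composition_operator_def by blast
  have "\<bar>r_seq lam beta r (Re b) n\<bar> \<le> C" for n
  proof -
    let ?e = "\<lambda>z. exp (- complex_of_real (lam n) * z)"
    have "dirichlet_norm lam beta (?e \<circ> (\<lambda>z. complex_of_real r * z + b))
            = exp (- lam n * Re b) * beta (m_index lam r n)"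
      using dirichlet_norm_monomial[of "?e \<circ> (\<lambda>z. complex_of_real r * z + b)"
              "exp (- complex_of_real (lam n) * b)" "m_index lam r n"]
            monomial_comp_affine[of n r b]
      by (simp add: lam_m_index[OF r])
    moreover have "dirichlet_norm lam beta ?e = beta n"
      using dirichlet_norm_monomial[of ?e 1 n] by simp
    ultimately show ?thesis
      using C[OF monomial_in_space[of n]] beta_pos[of n] beta_pos[of "m_index lam r n"]
      by (simp add: r_seq_def abs_mult field_simps)
  qed
  then show ?thesis by (auto simp: bounded_iff)
qed

lemma bounded_composition_imp:
  assumes bc: "bounded_composition_operator lam beta (\<lambda>z. a * z + b)"
  shows "(lam 0 = 0 \<and> a = 0 \<and> Re b > \<sigma>) \<or>
         (\<exists>r \<in> R_set lam. a = complex_of_real r \<and> Re b \<ge> (1 - r) * \<sigma> \<and>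
            bounded (range (r_seq lam beta r (Re b))))"
proof -
  have maps: "(\<lambda>z. a * z + b) ` half_plane \<sigma> \<subseteq> half_plane \<sigma>"
    using bc by (simp add: bounded_composition_operator_def)
  from affine_half_plane[OF maps] obtain r where
    r: "r \<ge> 0" "a = complex_of_real r" "Re b \<ge> (1 - r) * \<sigma>" .
  note bc' = bc[unfolded r(2)]
  note freq = bounded_composition_frequencies[OF bc']
  show ?thesis
  proof (cases "r = 0")
    case True
    \<comment> \<open>Now 0 is a frequency, and only the smallest frequency can vanish.\<close>
    obtain m where "lam m = 0" using freq[of 0] True by auto
    moreover have "lam 0 \<le> lam m" using lam_strict by (simp add: strict_mono_less_eq)
    ultimately have "lam 0 = 0" using lam_nonneg[of 0] by simp
    moreover have "Re b > \<sigma>"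
    proof -
      have "complex_of_real (\<sigma> + 1) \<in> half_plane \<sigma>" by (simp add: half_plane_def)
      then have "a * complex_of_real (\<sigma> + 1) + b \<in> half_plane \<sigma>" using maps by blast
      then show ?thesis by (simp add: r True half_plane_def)
    qed
    ultimately show ?thesis using r True by simp
  next
    case False
    then have "r \<in> R_set lam" using r freq by (intro multiplier_in_R_set) auto
    with bounded_composition_r_seq[OF bc'] r show ?thesis by blast
  qed
qed

end

section \<open>Bounded composition operators with affine symbol\<close>

theorem theorem3p13:
  fixes lam beta :: "nat \<Rightarrow> real" and a b :: complex
  assumes "strict_mono lam"
    and "\<And>n. lam n \<ge> 0"
    and "filterlim lam at_top sequentially"
    and "L_sup lam < \<infinity>"
    and "\<And>n. beta n > 0"
    and "beta_star lam beta \<noteq> \<infinity>"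
    and "beta_star lam beta \<noteq> - \<infinity>"
  shows "(lam 0 = 0 \<longrightarrow>
            (bounded_composition_operator lam beta (\<lambda>z. a * z + b) \<longleftrightarrow>
               (a = 0 \<and> Re b > abscissa lam beta) \<or>
               (\<exists>r \<in> R_set lam. a = complex_of_real r \<and>
                  Re b \<ge> (1 - r) * abscissa lam beta \<and>
                  bounded (range (r_seq lam beta r (Re b)))))) \<and>
         (lam 0 > 0 \<longrightarrow>
            (bounded_composition_operator lam beta (\<lambda>z. a * z + b) \<longleftrightarrow>
               (\<exists>r \<in> R_set lam. a = complex_of_real r \<and>
                  Re b \<ge> (1 - r) * abscissa lam beta \<and>
                  bounded (range (r_seq lam beta r (Re b))))))"
proof -
  interpret weighted_frequencies lam beta
    using assms by unfold_locales
  show ?thesis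
    using bounded_composition_imp[of a b] bounded_composition_constant[of b]
      bounded_composition_affine[of _ b]
    by auto
qed

end
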